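(* Let $\mathcal{GG}$ be the set of Göllnitz–Gordon partitions, that is, integer partitions $\lambda$ such that $\lambda_i-\lambda_{i+1}\ge 2$ for all $1\le i<\ell(\lambda)$, with strict inequality if either $\lambda_i$ or $\lambda_{i+1}$ is even. Let $\mathcal{G}$ be the set of Göllnitz partitions, that is, integer partitions $\lambda$ such that $\lambda_i-\lambda_{i+1}\ge 2$ for all $1\le i<\ell(\lambda)$, with strict inequality if either $\lambda_i$ or $\lambda_{i+1}$ is odd. Let $$f_{\mathcal{GG}}(x;q):=\sum_{\lambda\in\mathcal{GG}}x^{\ell(\lambda)}q^{|\lambda|},\qquad f_{\mathcal{G}}(x;q):=\sum_{\lambda\in\mathcal{G}}x^{\ell(\lambda)}q^{|\lambda|}.$$ Then $$f_{\mathcal{GG}}(x;q)=\sum_{k,m\ge 0}\frac{(-1)^k\,x^{m+2k}\,q^{m^2+4mk+6k^2}}{(q;q)_m\,(q^4;q^4)_k},$$ $$f_{\mathcal{G}}(x;q)=\sum_{k,m\ge 0}\frac{(-1)^k\,x^{m+2k}\,q^{m^2+4mk+6k^2-2k}}{(q;q)_m\,(q^4;q^4)_k}.$$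
   Context: For an integer partition $\lambda$ with (positive integer) parts $\lambda_1\ge\cdots\ge\lambda_\ell$, its size is $|\lambda|=\lambda_1+\cdots+\lambda_\ell$ and its length is $\ell(\lambda)=\ell$ (the number of parts); the empty partition is allowed, with size and length $0$. For an integer $n\ge 0$, $(a;q)_n=\prod_{k=0}^{n-1}(1-aq^k)$. The identities may be read as identities of formal power series in $q$ whose coefficients are polynomials in $x$ (equivalently, as identities of convergent series for complex $x$ and $|q|<1$). *)

theory Defs
  imports "HOL-Analysis.Analysis"
begin

text \<open>A partition is the list of its parts in weakly decreasing order, so that
  its size is \<^const>\<open>sum_list\<close> and its number of parts is \<^const>\<open>length\<close>.\<close>

definition is_partition :: "nat list \<Rightarrow> bool" where
  "is_partition l \<longleftrightarrow> sorted_wrt (\<ge>) l \<and> (\<forall>p \<in> set l. 0 < p)"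

text \<open>List indices start at 0. The subtractions below are on natural numbers, but
  a partition is weakly decreasing, so they are never truncated.\<close>

definition GG :: "nat list set" where
  "GG = {l. is_partition l \<and>
     (\<forall>i. Suc i < length l \<longrightarrow>
        l ! i - l ! Suc i \<ge> 2 \<and>
        (even (l ! i) \<or> even (l ! Suc i) \<longrightarrow> l ! i - l ! Suc i > 2))}"

definition G :: "nat list set" where
  "G = {l. is_partition l \<and>
     (\<forall>i. Suc i < length l \<longrightarrow>
        l ! i - l ! Suc i \<ge> 2 \<and>
        (odd (l ! i) \<or> odd (l ! Suc i) \<longrightarrow> l ! i - l ! Suc i > 2))}"

definition part_weight :: "complex \<Rightarrow> complex \<Rightarrow> nat list \<Rightarrow> complex" where
  "part_weight x q l = x ^ length l * q ^ sum_list l"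

definition f_GG :: "complex \<Rightarrow> complex \<Rightarrow> complex" where
  "f_GG x q = (\<Sum>\<^sub>\<infinity>l\<in>GG. part_weight x q l)"

definition f_G :: "complex \<Rightarrow> complex \<Rightarrow> complex" where
  "f_G x q = (\<Sum>\<^sub>\<infinity>l\<in>G. part_weight x q l)"

definition qpoch :: "complex \<Rightarrow> complex \<Rightarrow> nat \<Rightarrow> complex" where
  "qpoch a q n = (\<Prod>k<n. 1 - a * q ^ k)"

end

theory Submission
  imports Defs
begin

text \<open>Let \<open>a n\<close> be the sum of \<open>q\<close> to the power \<open>|\<lambda>|\<close> over the Goellnitz--Gordon partitions with \<open>n\<close>
  parts. Removing the smallest part, which is \<open>2t + 1\<close> or \<open>2t + 2\<close>, and subtracting \<open>2t + 2\<close> or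
  \<open>2t + 4\<close> from the others gives the first-order recurrence
  \<open>(1 - q^(2n)) a n = q^(2n-1) (1 + q^(2n-1)) a (n-1)\<close>. For Goellnitz partitions an odd shift
  \<open>2t + 3\<close> exchanges the parities, so their coefficients are expressed by \<open>a (n-1)\<close> as well.
  On the other side, \<open>m^2 + 4mk + 6k^2 = (m+2k)^2 + 2k^2\<close>, so the coefficient of \<open>x^n\<close> in the
  double series is \<open>q^(n^2)\<close> times that of \<open>z^n\<close> in a product of two power series,
  formally \<open>(z^2 q^2; q^4) / (z; q)\<close> with infinite products. The functional equations of the two
  factors under dilations of \<open>z\<close> yield the same recurrences.\<close>

unbundle no vec_syntax
unbundle fps_syntax
no_notation Infinite_Set_Sum.abs_summable_on (infix \<open>abs'_summable'_on\<close> 50)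

section \<open>The double series graded by the exponent of x\<close>

text \<open>With m = n - 2k this is the coefficient of x^n in the double series. The exponent of q
  beyond (m + 2k)^2 is left as a parameter \<open>e\<close>, to serve both identities.\<close>

definition graded_coeff :: "(nat \<Rightarrow> nat) \<Rightarrow> complex \<Rightarrow> nat \<Rightarrow> complex" where
  "graded_coeff e q n = q ^ n\<^sup>2 *
     (\<Sum>k\<le>n div 2. (-1) ^ k * q ^ e k / (qpoch q q (n - 2 * k) * qpoch (q ^ 4) (q ^ 4) k))"

section \<open>Pochhammer bounds and absolute convergence of the double series\<close>

lemma norm_one_minus_ge:
  fixes q :: complex
  assumes "norm q < 1"
  shows "1 - norm q \<le> norm (1 - q * q ^ k)"
proof -
  have "norm (q * q ^ k) \<le> norm q"
    using assms by (simp add: norm_mult norm_power mult_left_le power_le_one)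
  then show ?thesis
    using norm_triangle_ineq2[of 1 "q * q ^ k"] by simp
qed

text \<open>This bound is only exponential in n, which the quadratic exponents of q
  outweigh.\<close>

lemma norm_qpoch_ge:
  assumes "norm q < 1"
  shows "(1 - norm q) ^ n \<le> norm (qpoch q q n)"
proof -
  have "(\<Prod>k<n. 1 - norm q) \<le> (\<Prod>k<n. norm (1 - q * q ^ k))"
    using assms norm_one_minus_ge[OF assms] by (intro prod_mono) auto
  then show ?thesis
    by (simp add: qpoch_def prod_norm)
qed

lemma qpoch_nonzero:
  assumes "norm q < 1"
  shows "qpoch q q n \<noteq> 0"
proof -
  have "0 < (1 - norm q) ^ n" using assms by simp
  also have "\<dots> \<le> norm (qpoch q q n)" using assms by (rule norm_qpoch_ge)
  finally show ?thesis by simp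
qed

lemma one_minus_power_nonzero:
  fixes q :: complex
  assumes "norm q < 1" "0 < n"
  shows "1 - q ^ n \<noteq> 0"
proof
  assume "1 - q ^ n = 0"
  then have "norm q ^ n = 1" by (metis eq_iff_diff_eq_0 norm_one norm_power)
  moreover have "norm q ^ n < 1" using assms by (simp add: power_less_one_iff)
  ultimately show False by simp
qed

text \<open>Each term is the previous one times \<open>y * r ^ (2 * n + 1)\<close>, a factor tending
  to 0.\<close>

lemma summable_power_mult_power_square:
  fixes y r :: real
  assumes "0 \<le> y" "0 \<le> r" "r < 1"
  shows "(\<lambda>n. y ^ n * r ^ n\<^sup>2) summable_on UNIV"
proof -
  have "(\<lambda>n. r ^ n) \<longlonglongrightarrow> 0"
    using assms by (intro LIMSEQ_power_zero) auto
  from tendsto_mult_left[OF this, of y] have "(\<lambda>n. y * r ^ n) \<longlonglongrightarrow> 0"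
    by simp
  then have "\<forall>\<^sub>F n in sequentially. y * r ^ n < 1 / 2"
    by (rule order_tendstoD) auto
  then obtain N where N: "\<And>n. n \<ge> N \<Longrightarrow> y * r ^ n < 1 / 2"
    by (auto simp: eventually_sequentially)
  have "summable (\<lambda>n. norm (y ^ n * r ^ n\<^sup>2))"
  proof (rule summable_ratio_test[of "1 / 2" N])
    fix n assume "n \<ge> N"
    then have "y * r ^ (2 * n + 1) \<le> 1 / 2"
      using N[of "2 * n + 1"] by simp
    then have "(y * r ^ (2 * n + 1)) * (y ^ n * r ^ n\<^sup>2) \<le> 1 / 2 * (y ^ n * r ^ n\<^sup>2)"
      using assms by (intro mult_right_mono) auto
    moreover have "(Suc n)\<^sup>2 = (2 * n + 1) + n\<^sup>2"
      by (simp add: power2_eq_square)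
    then have "y ^ Suc n * r ^ (Suc n)\<^sup>2 = (y * r ^ (2 * n + 1)) * (y ^ n * r ^ n\<^sup>2)"
      by (simp only: power_add power_Suc mult_ac)
    ultimately have "y ^ Suc n * r ^ (Suc n)\<^sup>2 \<le> 1 / 2 * (y ^ n * r ^ n\<^sup>2)"
      by (simp only:)
    then show "norm (norm (y ^ Suc n * r ^ (Suc n)\<^sup>2)) \<le> 1 / 2 * norm (norm (y ^ n * r ^ n\<^sup>2))"
      using assms by (simp add: abs_mult del: power_Suc)
  qed auto
  then show ?thesis
    by (rule norm_summable_imp_summable_on)
qed

lemma abs_summable_on_Times:
  fixes f :: "'a \<Rightarrow> 'c::{real_normed_div_algebra, banach}"
  assumes "f abs_summable_on A" "g abs_summable_on B"
  shows "(\<lambda>(x, y). f x * g y) abs_summable_on A \<times> B"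
proof (rule summable_on_SigmaI)
  fix x
  show "((\<lambda>y. norm ((\<lambda>(x, y). f x * g y) (x, y))) has_sum norm (f x) * (\<Sum>\<^sub>\<infinity>y\<in>B. norm (g y))) B"
    using assms(2) by (auto simp: norm_mult intro!: has_sum_cmult_right)
next
  show "(\<lambda>x. norm (f x) * (\<Sum>\<^sub>\<infinity>y\<in>B. norm (g y))) summable_on A"
    using assms(1) by (rule summable_on_cmult_left)
qed auto

text \<open>The terms are dominated by a product of a series in k and one in m: (m + 2k)^2 is at
  least m^2 + k^2, and the Pochhammer bounds are absorbed into the bases \<open>Y\<close> and
  \<open>y\<close>. Any \<open>e\<close> is allowed, as it can only shrink the terms.\<close>

lemma double_series_summable:
  assumes "norm q < 1"
  shows "(\<lambda>(k, m). (-1) ^ k * x ^ (m + 2 * k) * q ^ ((m + 2 * k)\<^sup>2 + e k)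
              / (qpoch q q m * qpoch (q ^ 4) (q ^ 4) k)) summable_on UNIV"
    (is "?f summable_on _")
proof -
  define r y Y where "r = norm q" and "y = norm x / (1 - r)" and "Y = norm x ^ 2 / (1 - r)"
  have r: "0 \<le> r" "r < 1" using assms by (auto simp: r_def)
  have yY: "0 \<le> y" "0 \<le> Y" using r by (auto simp: y_def Y_def)
  have q4: "norm (q ^ 4) < 1"
    using assms by (simp add: norm_power power_less_one_iff)
  have "norm (q ^ 4) \<le> r"
    using r power_decreasing[of 1 4 r] by (simp add: norm_power r_def)
  then have r4: "1 - r \<le> 1 - norm (q ^ 4)" by simp
  define g where "g = (\<lambda>k. Y ^ k * r ^ k\<^sup>2)"
  define h where "h = (\<lambda>m. y ^ m * r ^ m\<^sup>2)"
  have "(\<lambda>k. norm (g k)) summable_on UNIV" "(\<lambda>k. norm (h k)) summable_on UNIV"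
    using summable_power_mult_power_square r yY by (simp_all add: g_def h_def abs_mult)
  from abs_summable_on_Times[OF this]
  have gh: "(\<lambda>(k, m). g k * h m) abs_summable_on UNIV \<times> UNIV" .
  have "?f abs_summable_on UNIV"
  proof (rule Infinite_Sum.abs_summable_on_comparison_test)
    show "(\<lambda>(k, m). g k * h m) abs_summable_on UNIV" using gh by simp
    fix p :: "nat \<times> nat"
    obtain k m where p: "p = (k, m)" by force
    have "(1 - r) ^ k \<le> (1 - norm (q ^ 4)) ^ k"
      using r r4 by (intro power_mono) auto
    then have k: "(1 - r) ^ k \<le> norm (qpoch (q ^ 4) (q ^ 4) k)"
      using norm_qpoch_ge[OF q4, of k] by simp
    have m: "(1 - r) ^ m \<le> norm (qpoch q q m)"
      using norm_qpoch_ge[OF assms, of m] by (simp add: r_def)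
    have exps: "r ^ ((m + 2 * k)\<^sup>2 + e k) \<le> r ^ (m\<^sup>2 + k\<^sup>2)"
      using r by (intro power_decreasing) (auto simp: power2_eq_square algebra_simps)
    have "norm (?f p) = norm x ^ (m + 2 * k) * r ^ ((m + 2 * k)\<^sup>2 + e k)
              / (norm (qpoch q q m) * norm (qpoch (q ^ 4) (q ^ 4) k))"
      by (simp add: p norm_mult norm_power norm_divide r_def)
    also have "\<dots> \<le> norm x ^ (m + 2 * k) * r ^ (m\<^sup>2 + k\<^sup>2) / ((1 - r) ^ m * (1 - r) ^ k)"
      using exps k m r by (intro frac_le mult_left_mono mult_mono) auto
    also have "norm x ^ (m + 2 * k) = norm x ^ m * (norm x ^ 2) ^ k"
      by (simp only: power_add power_mult)
    also have "norm x ^ m * (norm x ^ 2) ^ k * r ^ (m\<^sup>2 + k\<^sup>2) / ((1 - r) ^ m * (1 - r) ^ k) = g k * h m"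
      unfolding g_def h_def y_def Y_def power_divide power_add by (simp add: mult_ac)
    also have "\<dots> = norm (g k * h m)"
      using r yY by (simp add: g_def h_def)
    finally show "norm (?f p) \<le> norm ((\<lambda>(k, m). g k * h m) p)"
      by (simp add: p)
  qed
  then show ?thesis by (rule abs_summable_summable)
qed

section \<open>Both sides as series in x\<close>

lemma graded_coeff_has_sum:
  assumes "norm q < 1"
  shows "((\<lambda>n. x ^ n * graded_coeff e q n) has_sum
           (\<Sum>\<^sub>\<infinity>(k, m). (-1) ^ k * x ^ (m + 2 * k) * q ^ ((m + 2 * k)\<^sup>2 + e k)
              / (qpoch q q m * qpoch (q ^ 4) (q ^ 4) k))) UNIV"
    (is "(_ has_sum infsum ?f UNIV) _")
proof -
  \<comment> \<open>The pair (k, m) goes to the fibre of n = m + 2k, where k is at most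
    \<open>n div 2\<close> and n - 2k is not truncated.\<close>
  have "((\<lambda>(n, k). ?f (k, n - 2 * k)) has_sum infsum ?f UNIV) (SIGMA n:UNIV. {..n div 2})
          = (?f has_sum infsum ?f UNIV) UNIV"
    by (rule has_sum_reindex_bij_witness[of _ "\<lambda>(k, m). (m + 2 * k, k)" "\<lambda>(n, k). (k, n - 2 * k)"]) auto
  moreover have "(?f has_sum infsum ?f UNIV) UNIV"
    using double_series_summable[OF assms] by (rule has_sum_infsum)
  ultimately have "((\<lambda>(n, k). ?f (k, n - 2 * k)) has_sum infsum ?f UNIV) (SIGMA n:UNIV. {..n div 2})"
    by simp
  then show ?thesis
  proof (rule has_sum_SigmaD)
    fix n :: nat
    have "(\<Sum>k\<le>n div 2. ?f (k, n - 2 * k)) = x ^ n * graded_coeff e q n"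
      unfolding graded_coeff_def sum_distrib_left
    proof (intro sum.cong refl)
      fix k assume "k \<in> {..n div 2}"
      then have e: "n - 2 * k + 2 * k = n" by auto
      show "?f (k, n - 2 * k) = x ^ n * (q ^ n\<^sup>2 *
          ((-1) ^ k * q ^ e k / (qpoch q q (n - 2 * k) * qpoch (q ^ 4) (q ^ 4) k)))"
        by (simp only: prod.case e) (simp add: power_add mult_ac)
    qed
    then show "((\<lambda>k. (\<lambda>(n, k). ?f (k, n - 2 * k)) (n, k)) has_sum x ^ n * graded_coeff e q n) {..n div 2}"
      by (intro has_sum_finiteI) auto
  qed
qed

text \<open>Reduces an identity to fixed lengths: once the partitions with n parts are summed for
  each n, both sides are the same series in x.\<close>

lemma part_weight_has_sum_double_series:
  assumes q: "norm q < 1"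
    and fibre: "\<And>q n. norm q < 1 \<Longrightarrow>
      ((\<lambda>l. q ^ sum_list l) has_sum graded_coeff e q n) {l \<in> S. length l = n}"
  shows "part_weight x q summable_on S \<and>
    ((\<lambda>(k, m). (-1) ^ k * x ^ (m + 2 * k) * q ^ ((m + 2 * k)\<^sup>2 + e k)
       / (qpoch q q m * qpoch (q ^ 4) (q ^ 4) k)) has_sum infsum (part_weight x q) S) UNIV"
    (is "_ \<and> (?f has_sum _) _")
proof -
  define B where "B = (\<lambda>n. {l \<in> S. length l = n})"
  have bij: "bij_betw snd (Sigma UNIV B) S"
    by (rule bij_betwI[of _ _ _ "\<lambda>l. (length l, l)"]) (auto simp: B_def)
  have fib: "((\<lambda>l. part_weight X Q l) has_sum X ^ n * graded_coeff e Q n) (B n)"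
    if "norm Q < 1" for X Q n
  proof -
    have "((\<lambda>l. X ^ n * Q ^ sum_list l) has_sum X ^ n * graded_coeff e Q n) (B n)"
      using fibre[OF that] unfolding B_def by (intro has_sum_cmult_right)
    then show ?thesis
      by (rule has_sum_cong[THEN iffD1, rotated]) (simp add: part_weight_def B_def)
  qed
  \<comment> \<open>The hypothesis for \<open>|x|\<close> and \<open>|q|\<close> supplies the absolute summability.\<close>
  define X Q where "X = complex_of_real (norm x)" and "Q = complex_of_real (norm q)"
  have Q: "norm Q < 1" using q by (simp add: Q_def)
  have pw: "part_weight X Q l = of_real (norm (part_weight x q l))" for l
    by (simp add: part_weight_def X_def Q_def norm_mult norm_power)
  have norm_fib: "((\<lambda>l. norm (part_weight x q l)) has_sum Re (X ^ n * graded_coeff e Q n)) (B n)" for n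
    using has_sum_Re[OF fib[OF Q, of X n]] by (simp add: pw)
  have "(\<lambda>n. Re (X ^ n * graded_coeff e Q n)) summable_on UNIV"
    using has_sum_Re[OF graded_coeff_has_sum[OF Q, of X e]] by (rule has_sum_imp_summable)
  then have "(\<lambda>p. norm (part_weight x q (snd p))) summable_on Sigma UNIV B"
    using norm_fib by (intro summable_on_SigmaI) auto
  then have summ: "(\<lambda>p. part_weight x q (snd p)) summable_on Sigma UNIV B"
    by (rule abs_summable_summable)
  then have summS: "part_weight x q summable_on S"
    using summable_on_reindex_bij_betw[OF bij] by blast
  have "((\<lambda>p. part_weight x q (snd p)) has_sum infsum (part_weight x q) S) (Sigma UNIV B)"
    using summS has_sum_reindex_bij_betw[OF bij] has_sum_infsum by blast
  then have "((\<lambda>n. x ^ n * graded_coeff e q n) has_sum infsum (part_weight x q) S) UNIV"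
    by (rule has_sum_SigmaD) (use fib[OF q] in simp)
  then have "infsum (part_weight x q) S = infsum ?f UNIV"
    using graded_coeff_has_sum[OF q] by (rule has_sum_unique)
  moreover have "(?f has_sum infsum ?f UNIV) UNIV"
    using double_series_summable[OF q] by (rule has_sum_infsum)
  ultimately show ?thesis
    using summS by (simp only:)
qed

section \<open>Recurrences for the coefficients\<close>

definition reciprocal_fps :: "complex \<Rightarrow> complex fps" where
  "reciprocal_fps q = Abs_fps (\<lambda>m. 1 / qpoch q q m)"

text \<open>For \<open>e k = 2k^2\<close> this is Euler's expansion of the infinite product \<open>(z^2 q^2; q^4)\<close>, and for
  \<open>e k = 2k^2 - 2k\<close> of \<open>(z^2; q^4)\<close>; \<open>reciprocal_fps q\<close> is that of \<open>1 / (z; q)\<close>.\<close>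

definition even_fps :: "(nat \<Rightarrow> nat) \<Rightarrow> complex \<Rightarrow> complex fps" where
  "even_fps e q = Abs_fps (\<lambda>j. if even j
     then (-1) ^ (j div 2) * q ^ e (j div 2) / qpoch (q ^ 4) (q ^ 4) (j div 2) else 0)"

text \<open>In the Cauchy product only the indices 2k contribute, because the first factor has no
  odd coefficients.\<close>

lemma graded_coeff_eq:
  "graded_coeff e q n = q ^ n\<^sup>2 * (even_fps e q * reciprocal_fps q) $ n"
proof -
  define F where "F = (\<lambda>i. even_fps e q $ i * reciprocal_fps q $ (n - i))"
  have "(even_fps e q * reciprocal_fps q) $ n = sum F {0..n}"
    by (simp add: fps_mult_nth F_def)
  also have "\<dots> = sum F ((\<lambda>k. 2 * k) ` {..n div 2})"
    by (rule sum.mono_neutral_right) (auto simp: F_def even_fps_def elim!: evenE)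
  also have "\<dots> = (\<Sum>k\<le>n div 2. F (2 * k))"
    by (subst sum.reindex) (auto simp: inj_on_def)
  also have "\<dots> = (\<Sum>k\<le>n div 2. (-1) ^ k * q ^ e k / (qpoch q q (n - 2 * k) * qpoch (q ^ 4) (q ^ 4) k))"
    by (intro sum.cong) (auto simp: F_def even_fps_def reciprocal_fps_def mult_ac)
  finally show ?thesis by (simp add: graded_coeff_def)
qed

section \<open>Functional equations under dilation of z\<close>

abbreviation dilate :: "complex \<Rightarrow> complex fps \<Rightarrow> complex fps" where
  "dilate c F \<equiv> fps_compose F (fps_const c * fps_X)"

lemma dilate_mult: "dilate c (F * H) = dilate c F * dilate c H"
  by (intro fps_compose_mult_distrib) simp

lemma dilate_dilate: "dilate c (dilate d F) = dilate (c * d) F"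
  by (rule fps_ext) (simp add: power_mult_distrib)

text \<open>In product form, z -> qz drops the factor 1 - z from the denominator (z; q).\<close>

lemma reciprocal_fps_dilate:
  assumes "norm q < 1"
  shows "dilate q (reciprocal_fps q) = (1 - fps_X) * reciprocal_fps q"
proof (rule fps_ext)
  fix n
  show "dilate q (reciprocal_fps q) $ n = ((1 - fps_X) * reciprocal_fps q) $ n"
  proof (cases n)
    case (Suc m)
    have "qpoch q q m \<noteq> 0" "1 - q * q ^ m \<noteq> 0"
      using qpoch_nonzero[OF assms] one_minus_power_nonzero[OF assms, of "Suc m"] by auto
    then show ?thesis
      by (simp add: Suc reciprocal_fps_def qpoch_def left_diff_distrib divide_simps) (simp add: algebra_simps)
  qed (simp add: reciprocal_fps_def qpoch_def left_diff_distrib)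
qed

lemma reciprocal_fps_dilate_square:
  assumes "norm q < 1"
  shows "dilate (q\<^sup>2) (reciprocal_fps q)
    = (1 - fps_const q * fps_X) * (1 - fps_X) * reciprocal_fps q"
proof -
  have "dilate (q\<^sup>2) (reciprocal_fps q) = dilate q (dilate q (reciprocal_fps q))"
    by (simp only: dilate_dilate power2_eq_square)
  also have "\<dots> = dilate q (1 - fps_X) * dilate q (reciprocal_fps q)"
    by (simp only: reciprocal_fps_dilate[OF assms] dilate_mult)
  also have "dilate q (1 - fps_X) = 1 - fps_const q * fps_X"
    by (simp add: fps_compose_sub_distrib)
  finally show ?thesis
    by (simp only: reciprocal_fps_dilate[OF assms] mult.assoc)
qed

lemma qpoch_Suc: "qpoch a q (Suc n) = qpoch a q n * (1 - a * q ^ n)"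
  by (simp add: qpoch_def)

text \<open>In product form, z -> q^2 z takes z^2 q^2 to z^2 q^6, which removes the first factor of
  (z^2 q^2; q^4). The proof compares coefficients.\<close>

lemma even_fps_GG_dilate:
  assumes "norm q < 1"
  shows "even_fps (\<lambda>k. 2 * k\<^sup>2) q
    = (1 - fps_const (q\<^sup>2) * fps_X\<^sup>2) * dilate (q\<^sup>2) (even_fps (\<lambda>k. 2 * k\<^sup>2) q)"
    (is "?L = ?R")
proof (rule fps_ext)
  fix n :: nat
  \<comment> \<open>The factor X^2 shifts indices by two, hence the separate case n < 2. Odd
    coefficients vanish on both sides; n = 2k + 2 involves the neighbouring even coefficients k and
    k + 1.\<close>
  have "n < 2 \<or> (\<exists>k. n = 2 * k + 3) \<or> (\<exists>k. n = 2 * k + 2)" by presburger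
  then consider "n < 2" | k where "n = 2 * k + 3" | k where "n = 2 * k + 2" by blast
  then show "?L $ n = ?R $ n"
  proof cases
    case 1
    then have "n = 0 \<or> n = 1" by auto
    then show ?thesis
      by (auto simp: even_fps_def left_diff_distrib mult.assoc fps_X_power_mult_nth qpoch_def)
  next
    case 2
    then show ?thesis
      by (simp add: even_fps_def left_diff_distrib mult.assoc fps_X_power_mult_nth)
  next
    case (3 k)
    have q4: "norm (q ^ 4) < 1"
      using assms by (simp add: norm_power power_less_one_iff)
    have nz: "qpoch (q ^ 4) (q ^ 4) k \<noteq> 0" "1 - q ^ 4 * (q ^ 4) ^ k \<noteq> 0"
      using qpoch_nonzero[OF q4] one_minus_power_nonzero[OF q4, of "Suc k"] by auto
    define A u where "A = q ^ (2 * k\<^sup>2)" and "u = (q ^ 4) ^ k"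
    have u: "u = q ^ (4 * k)"
      by (simp add: u_def power_mult)
    have "2 * (Suc k)\<^sup>2 = 2 * k\<^sup>2 + 4 * k + 2"
      by (simp add: power2_eq_square)
    then have e1: "q ^ (2 * (Suc k)\<^sup>2) = A * u * q\<^sup>2"
      by (simp only: power_add A_def u)
    have e2: "(q\<^sup>2) ^ (2 * k) = u"
      by (simp add: u flip: power_mult)
    have e3: "(q\<^sup>2) ^ (2 * k + 2) = u * q ^ 4"
      by (simp only: power_add e2) (simp flip: power_mult)
    have L: "?L $ n = - ((-1) ^ k) * (A * u * q\<^sup>2) / (qpoch (q ^ 4) (q ^ 4) k * (1 - q ^ 4 * u))"
      using 3 e1 by (simp add: even_fps_def qpoch_Suc u_def)
    have R: "?R $ n = u * q ^ 4 * (- ((-1) ^ k) * (A * u * q\<^sup>2) / (qpoch (q ^ 4) (q ^ 4) k * (1 - q ^ 4 * u)))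
        - q\<^sup>2 * (u * ((-1) ^ k * A / qpoch (q ^ 4) (q ^ 4) k))"
      using 3 e1 e2 e3 by (simp add: even_fps_def qpoch_Suc u_def A_def left_diff_distrib mult.assoc fps_X_power_mult_nth)
    show ?thesis
      unfolding L R using nz unfolding u_def[symmetric] by (simp add: divide_simps) (simp add: algebra_simps)
  qed
qed

text \<open>In product form, z -> qz takes z^2 q^2 to z^2 q^4, leaving (z^2; q^4) without its first
  factor 1 - z^2.\<close>

lemma even_fps_G_eq:
  assumes "norm q < 1"
  shows "even_fps (\<lambda>k. 2 * k\<^sup>2 - 2 * k) q
    = (1 - fps_X\<^sup>2) * dilate q (even_fps (\<lambda>k. 2 * k\<^sup>2) q)"
    (is "?L = ?R")
proof (rule fps_ext)
  fix n :: nat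
  have "n < 2 \<or> (\<exists>k. n = 2 * k + 3) \<or> (\<exists>k. n = 2 * k + 2)" by presburger
  then consider "n < 2" | k where "n = 2 * k + 3" | k where "n = 2 * k + 2" by blast
  then show "?L $ n = ?R $ n"
  proof cases
    case 1
    then have "n = 0 \<or> n = 1" by auto
    then show ?thesis
      by (auto simp: even_fps_def left_diff_distrib mult.assoc fps_X_power_mult_nth qpoch_def)
  next
    case 2
    then show ?thesis
      by (simp add: even_fps_def left_diff_distrib mult.assoc fps_X_power_mult_nth)
  next
    case (3 k)
    have q4: "norm (q ^ 4) < 1"
      using assms by (simp add: norm_power power_less_one_iff)
    have nz: "qpoch (q ^ 4) (q ^ 4) k \<noteq> 0" "1 - q ^ 4 * (q ^ 4) ^ k \<noteq> 0"
      using qpoch_nonzero[OF q4] one_minus_power_nonzero[OF q4, of "Suc k"] by auto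
    define A v where "A = q ^ (2 * k\<^sup>2)" and "v = q ^ (2 * k)"
    have u: "(q ^ 4) ^ k = v * v"
      by (simp add: v_def flip: power_mult power_add)
    have q22: "q * (q * q\<^sup>2) = q ^ 4"
      by (simp add: power2_eq_square power4_eq_xxxx)
    have "2 * (Suc k)\<^sup>2 - 2 * Suc k = 2 * k\<^sup>2 + 2 * k"
      by (simp add: power2_eq_square)
    then have e: "q ^ (2 * (Suc k)\<^sup>2 - 2 * Suc k) = A * v"
      by (simp only: power_add A_def v_def)
    have "2 * (Suc k)\<^sup>2 = 2 * k\<^sup>2 + 2 * k + 2 * k + 2"
      by (simp add: power2_eq_square)
    then have e': "q ^ (2 * (Suc k)\<^sup>2) = A * v * v * q\<^sup>2" "q ^ (2 * k + 2) = v * q\<^sup>2"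
      by (simp_all only: power_add A_def v_def)
    have L: "?L $ n = - ((-1) ^ k) * (A * v) / (qpoch (q ^ 4) (q ^ 4) k * (1 - q ^ 4 * (v * v)))"
      using 3 e by (simp add: even_fps_def qpoch_Suc u)
    have R: "?R $ n = v * q\<^sup>2 * (- ((-1) ^ k) * (A * v * v * q\<^sup>2) / (qpoch (q ^ 4) (q ^ 4) k * (1 - q ^ 4 * (v * v))))
        - v * ((-1) ^ k * A / qpoch (q ^ 4) (q ^ 4) k)"
      using 3 e' by (simp add: q22 even_fps_def qpoch_Suc u A_def v_def left_diff_distrib mult.assoc fps_X_power_mult_nth)
    show ?thesis
      unfolding L R using nz unfolding u by (simp add: divide_simps) (simp add: algebra_simps q22)
  qed
qed

text \<open>Dilating \<open>D\<close> by q^2 yields (1 - qz)(1 - z) from the reciprocal factor.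
  Multiplying by 1 + qz completes 1 - qz to 1 - q^2 z^2, exactly the factor that the dilated even
  series has lost.\<close>

lemma product_fps_dilate:
  assumes "norm q < 1"
  defines "D \<equiv> even_fps (\<lambda>k. 2 * k\<^sup>2) q * reciprocal_fps q"
  shows "(1 + fps_const q * fps_X) * dilate (q\<^sup>2) D = (1 - fps_X) * D"
proof -
  define E P E' where "E = even_fps (\<lambda>k. 2 * k\<^sup>2) q" and "P = reciprocal_fps q"
    and "E' = dilate (q\<^sup>2) (even_fps (\<lambda>k. 2 * k\<^sup>2) q)"
  define Z :: "complex fps" where "Z = fps_const q * fps_X"
  have "fps_const (q\<^sup>2) * fps_X\<^sup>2 = Z * Z"
    by (simp add: Z_def power2_eq_square fps_const_mult[symmetric] algebra_simps del: fps_const_mult)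
  then have E: "E = (1 - Z * Z) * E'"
    using even_fps_GG_dilate[OF assms(1)] by (simp add: E_def E'_def)
  have "dilate (q\<^sup>2) D = E' * ((1 - Z) * (1 - fps_X) * P)"
    unfolding D_def dilate_mult reciprocal_fps_dilate_square[OF assms(1)] by (simp add: E'_def P_def Z_def)
  then have "(1 + Z) * dilate (q\<^sup>2) D = (1 + Z) * (E' * ((1 - Z) * (1 - fps_X) * P))"
    by (rule arg_cong)
  also have "\<dots> = (1 - fps_X) * (((1 - Z * Z) * E') * P)"
    by (simp add: algebra_simps)
  finally show ?thesis
    unfolding E[symmetric] by (simp add: D_def E_def P_def Z_def)
qed

text \<open>Compares the coefficients of z^(n+1) in the functional equation; passing from q^(n^2) to
  q^((n+1)^2) contributes q^(2n+1).\<close>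

lemma graded_coeff_GG_Suc:
  assumes "norm q < 1"
  shows "graded_coeff (\<lambda>k. 2 * k\<^sup>2) q (Suc n) * (1 - q ^ (2 * Suc n))
    = (q ^ (2 * n + 1) + q ^ (4 * n + 2)) * graded_coeff (\<lambda>k. 2 * k\<^sup>2) q n"
proof -
  define D where "D = even_fps (\<lambda>k. 2 * k\<^sup>2) q * reciprocal_fps q"
  have "((1 + fps_const q * fps_X) * dilate (q\<^sup>2) D) $ Suc n = ((1 - fps_X) * D) $ Suc n"
    using product_fps_dilate[OF assms] by (simp add: D_def)
  then have "(q\<^sup>2) ^ Suc n * D $ Suc n + q * ((q\<^sup>2) ^ n * D $ n) = D $ Suc n - D $ n"
    by (simp add: distrib_right left_diff_distrib mult.assoc)
  then have "D $ Suc n * (1 - q ^ (2 * Suc n)) = (1 + q ^ (2 * n + 1)) * D $ n"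
    by (simp only: power_mult power_add power_one_right) (simp only: algebra_simps mult_1_left)
  then have "q ^ (Suc n)\<^sup>2 * (D $ Suc n * (1 - q ^ (2 * Suc n)))
    = q ^ (Suc n)\<^sup>2 * ((1 + q ^ (2 * n + 1)) * D $ n)" by simp
  moreover have "(Suc n)\<^sup>2 = (2 * n + 1) + n\<^sup>2" "4 * n + 2 = (2 * n + 1) + (2 * n + 1)"
    by (simp_all add: power2_eq_square)
  then have "q ^ (Suc n)\<^sup>2 * (1 + q ^ (2 * n + 1)) = (q ^ (2 * n + 1) + q ^ (4 * n + 2)) * q ^ n\<^sup>2"
    by (simp only: power_add algebra_simps mult_1_right mult_1_left)
  ultimately show ?thesis
    unfolding graded_coeff_eq D_def[symmetric] by (metis mult.assoc)
qed

text \<open>Writing 1 - z^2 = (1 + z)(1 - z), the factor 1 - z dilates \<open>P\<close>, so the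
  product for G is 1 + z times the dilated product for GG. This brings in the GG coefficients n + 1
  and n, and the GG recurrence eliminates the former.\<close>

lemma graded_coeff_G_Suc:
  assumes "norm q < 1"
  shows "graded_coeff (\<lambda>k. 2 * k\<^sup>2 - 2 * k) q (Suc n) * (1 - q ^ (2 * Suc n))
    = (q ^ (3 * n + 1) + q ^ (3 * n + 2)) * graded_coeff (\<lambda>k. 2 * k\<^sup>2) q n"
proof -
  define E P E' where "E = even_fps (\<lambda>k. 2 * k\<^sup>2) q" and "P = reciprocal_fps q"
    and "E' = even_fps (\<lambda>k. 2 * k\<^sup>2 - 2 * k) q"
  have "E' * P = (1 + fps_X) * (dilate q E * ((1 - fps_X) * P))"
    unfolding E'_def even_fps_G_eq[OF assms] E_def by (simp add: algebra_simps power2_eq_square)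
  also have "\<dots> = (1 + fps_X) * dilate q (E * P)"
    unfolding dilate_mult by (simp add: P_def reciprocal_fps_dilate[OF assms])
  finally have "(E' * P) $ Suc n = q ^ Suc n * (E * P) $ Suc n + q ^ n * (E * P) $ n"
    by (simp add: distrib_right)
  then have Suc: "graded_coeff (\<lambda>k. 2 * k\<^sup>2 - 2 * k) q (Suc n)
    = q ^ Suc n * graded_coeff (\<lambda>k. 2 * k\<^sup>2) q (Suc n)
      + q ^ (3 * n + 1) * graded_coeff (\<lambda>k. 2 * k\<^sup>2) q n"
    unfolding graded_coeff_eq E_def[symmetric] P_def[symmetric] E'_def[symmetric]
    by (simp add: algebra_simps power2_eq_square power_add power3_eq_cube mult_2 mult_2_right numeral_3_eq_3)
  have "graded_coeff (\<lambda>k. 2 * k\<^sup>2 - 2 * k) q (Suc n) * (1 - q ^ (2 * Suc n))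
    = q ^ Suc n * ((q ^ (2 * n + 1) + q ^ (4 * n + 2)) * graded_coeff (\<lambda>k. 2 * k\<^sup>2) q n)
      + q ^ (3 * n + 1) * (1 - q ^ (2 * Suc n)) * graded_coeff (\<lambda>k. 2 * k\<^sup>2) q n"
    unfolding Suc graded_coeff_GG_Suc[OF assms, of n, symmetric] by (simp only: distrib_left distrib_right mult_ac)
  also have "\<dots> = (q ^ Suc n * (q ^ (2 * n + 1) + q ^ (4 * n + 2)) + q ^ (3 * n + 1) * (1 - q ^ (2 * Suc n)))
      * graded_coeff (\<lambda>k. 2 * k\<^sup>2) q n"
    by (simp only: distrib_right mult.assoc)
  \<comment> \<open>The two terms q^(5n+3) cancel.\<close>
  also have "q ^ Suc n * (q ^ (2 * n + 1) + q ^ (4 * n + 2)) + q ^ (3 * n + 1) * (1 - q ^ (2 * Suc n))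
      = q ^ (3 * n + 1) + q ^ (3 * n + 2)"
    by (simp add: algebra_simps flip: power_add power_Suc)
  finally show ?thesis .
qed

section \<open>Removing the smallest part\<close>

text \<open>Imposing \<open>R\<close> on all pairs makes it easy to remove the last part. For the
  transitive gap relations below this agrees with the condition on neighbours.\<close>

definition gapped :: "(nat \<Rightarrow> nat \<Rightarrow> bool) \<Rightarrow> nat list set" where
  "gapped R = {l. sorted_wrt R l \<and> (\<forall>p \<in> set l. 0 < p)}"

definition gap_GG :: "nat \<Rightarrow> nat \<Rightarrow> bool" where
  "gap_GG a b \<longleftrightarrow> b + 2 \<le> a \<and> (even a \<or> even b \<longrightarrow> b + 2 < a)"

definition gap_G :: "nat \<Rightarrow> nat \<Rightarrow> bool" where
  "gap_G a b \<longleftrightarrow> b + 2 \<le> a \<and> (odd a \<or> odd b \<longrightarrow> b + 2 < a)"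

lemma GG_eq_gapped: "GG = gapped gap_GG"
proof -
  have "transp gap_GG" by (auto simp: transp_def gap_GG_def)
  moreover have "sorted_wrt (\<ge>) l" if "sorted_wrt gap_GG l" for l
    using that by (rule sorted_wrt_mono_rel[rotated]) (auto simp: gap_GG_def)
  ultimately show ?thesis
    unfolding GG_def gapped_def is_partition_def
    by (auto simp: sorted_wrt_iff_nth_Suc_transp gap_GG_def)
qed

lemma G_eq_gapped: "G = gapped gap_G"
proof -
  have "transp gap_G" by (auto simp: transp_def gap_G_def)
  moreover have "sorted_wrt (\<ge>) l" if "sorted_wrt gap_G l" for l
    using that by (rule sorted_wrt_mono_rel[rotated]) (auto simp: gap_G_def)
  ultimately show ?thesis
    unfolding G_def gapped_def is_partition_def
    by (auto simp: sorted_wrt_iff_nth_Suc_transp gap_G_def)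
qed

text \<open>Inverse of removing the smallest part: \<open>p\<close> fixes its parity,
  \<open>t\<close> indexes it, and \<open>r\<close> determines the shift taken off the
  others.\<close>

definition attach :: "nat \<Rightarrow> nat \<Rightarrow> nat \<times> nat list \<Rightarrow> nat list" where
  "attach p r = (\<lambda>(t, l). map (\<lambda>a. a + (2 * t + r)) l @ [2 * t + p])"

lemma inj_attach: "inj (attach p r)"
  by (auto simp: inj_def attach_def inj_map_eq_map)

text \<open>By \<open>last\<close>, the parts allowed above 2t + p are exactly those that stay
  positive after the shift; by \<open>shift\<close>, the gaps among them are then governed by
  \<open>R'\<close>.\<close>

lemma attach_image:
  assumes "0 < p"
    and last: "\<And>t a. R a (2 * t + p) \<longleftrightarrow> 2 * t + r < a"
    and shift: "\<And>t a b. R (a + (2 * t + r)) (b + (2 * t + r)) \<longleftrightarrow> R' a b"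
  shows "attach p r ` (UNIV \<times> {l \<in> gapped R'. length l = n})
    = {l \<in> gapped R. length l = Suc n \<and> last l \<in> range (\<lambda>t. 2 * t + p)}"
proof (intro subset_antisym subsetI)
  fix l assume "l \<in> attach p r ` (UNIV \<times> {l \<in> gapped R'. length l = n})"
  then show "l \<in> {l \<in> gapped R. length l = Suc n \<and> last l \<in> range (\<lambda>t. 2 * t + p)}"
    using assms(1) by (auto simp: attach_def gapped_def sorted_wrt_append sorted_wrt_map last shift)
next
  fix l assume l: "l \<in> {l \<in> gapped R. length l = Suc n \<and> last l \<in> range (\<lambda>t. 2 * t + p)}"
  then obtain t where t: "last l = 2 * t + p" by auto
  obtain l0 where l0: "l = l0 @ [2 * t + p]"
    using l t by (metis (mono_tags) append_butlast_last_id length_0_conv mem_Collect_eq nat.distinct(1))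
  define l' where "l' = map (\<lambda>a. a - (2 * t + r)) l0"
  have gt: "2 * t + r < a" if "a \<in> set l0" for a
    using l that by (simp add: l0 gapped_def sorted_wrt_append last)
  then have l0': "l0 = map (\<lambda>a. a + (2 * t + r)) l'"
    unfolding l'_def map_map o_def by (metis (no_types, lifting) le_add_diff_inverse2 less_imp_le map_idI)
  have "sorted_wrt R l0" using l by (simp add: l0 gapped_def sorted_wrt_append)
  then have "sorted_wrt R' l'"
    by (subst (asm) l0') (simp add: sorted_wrt_map shift)
  then have "l' \<in> {l \<in> gapped R'. length l = n}"
    using l gt by (auto simp: gapped_def l'_def l0)
  moreover have "l = attach p r (t, l')"
    by (simp add: attach_def l0 flip: l0')
  ultimately show "l \<in> attach p r ` (UNIV \<times> {l \<in> gapped R'. length l = n})" by blast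
qed

text \<open>Raising t by one adds 2 to each of the n + 1 parts, so the sum over t is geometric in
  q^(2(n+1)). At t = 0 the size grows by rn + p.\<close>

lemma attach_has_sum:
  fixes q :: complex
  assumes q: "norm q < 1"
    and a: "((\<lambda>l. q ^ sum_list l) has_sum a) L"
    and len: "\<And>l. l \<in> L \<Longrightarrow> length l = n"
  shows "((\<lambda>l. q ^ sum_list l) has_sum q ^ (r * n + p) * a / (1 - q ^ (2 * Suc n))) (attach p r ` (UNIV \<times> L))"
proof -
  define z where "z = q ^ (2 * Suc n)"
  have z: "norm z < 1"
    unfolding z_def norm_power by (subst power_less_one_iff) (use q in auto)
  have geom: "((\<lambda>t. z ^ t) has_sum 1 / (1 - z)) UNIV"
    using z by (intro norm_summable_imp_has_sum geometric_sums) (simp_all add: norm_power summable_geometric)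
  \<comment> \<open>Complex summability is absolute, which makes the product family
    summable.\<close>
  have "(\<lambda>(t, l). z ^ t * q ^ sum_list l) abs_summable_on UNIV \<times> L"
    using geom a
    by (intro abs_summable_on_Times) (auto simp flip: summable_on_iff_abs_summable_on_complex dest: has_sum_imp_summable)
  then have "(\<lambda>(t, l). z ^ t * q ^ sum_list l) summable_on UNIV \<times> L"
    by (rule abs_summable_summable)
  then have "((\<lambda>(t, l). z ^ t * q ^ sum_list l) has_sum 1 / (1 - z) * a) (UNIV \<times> L)"
    using has_sum_cmult_right[OF a] has_sum_cmult_left[OF geom, of a]
    by (intro has_sum_SigmaI[where g = "\<lambda>t. z ^ t * a"]) auto
  from has_sum_cmult_right[OF this, of "q ^ (r * n + p)"]
  have "((\<lambda>u. q ^ (r * n + p) * (\<lambda>(t, l). z ^ t * q ^ sum_list l) u) has_sum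
      q ^ (r * n + p) * a / (1 - z)) (UNIV \<times> L)"
    by simp
  moreover have "q ^ (r * n + p) * (\<lambda>(t, l). z ^ t * q ^ sum_list l) u = q ^ sum_list (attach p r u)"
    if "u \<in> UNIV \<times> L" for u
  proof -
    obtain t l where u: "u = (t, l)" "length l = n" using len \<open>u \<in> UNIV \<times> L\<close> by auto
    have "sum_list (attach p r u) = (r * n + p) + 2 * Suc n * t + sum_list l"
      using u by (simp add: attach_def sum_list_addf sum_list_triv algebra_simps)
    then show ?thesis
      by (simp only: power_add z_def power_mult) (simp add: u)
  qed
  ultimately have "((\<lambda>u. q ^ sum_list (attach p r u)) has_sum q ^ (r * n + p) * a / (1 - z)) (UNIV \<times> L)"
    by (simp cong: has_sum_cong)
  then show ?thesis
    using has_sum_reindex[OF inj_on_subset[OF inj_attach subset_UNIV], of "\<lambda>l. q ^ sum_list l"]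
    by (simp add: o_def z_def)
qed

text \<open>The smallest part is 2t + 1 or 2t + 2, so two disjoint images of \<open>attach\<close>
  cover everything. The equation for \<open>b\<close> determines it, because 1 - q^(2(n+1)) is
  nonzero.\<close>

lemma gapped_Suc_has_sum:
  fixes q :: complex
  assumes q: "norm q < 1"
    and odd_last: "\<And>t a. R a (2 * t + 1) \<longleftrightarrow> 2 * t + r < a"
    and odd_shift: "\<And>t a b. R (a + (2 * t + r)) (b + (2 * t + r)) \<longleftrightarrow> R' a b"
    and even_last: "\<And>t a. R a (2 * t + 2) \<longleftrightarrow> 2 * t + s < a"
    and even_shift: "\<And>t a b. R (a + (2 * t + s)) (b + (2 * t + s)) \<longleftrightarrow> R' a b"
    and a: "((\<lambda>l. q ^ sum_list l) has_sum a) {l \<in> gapped R'. length l = n}"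
    and b: "b * (1 - q ^ (2 * Suc n)) = (q ^ (r * n + 1) + q ^ (s * n + 2)) * a"
  shows "((\<lambda>l. q ^ sum_list l) has_sum b) {l \<in> gapped R. length l = Suc n}"
proof -
  define A where "A = {l \<in> gapped R'. length l = n}"
  have odd: "attach 1 r ` (UNIV \<times> A) = {l \<in> gapped R. length l = Suc n \<and> last l \<in> range (\<lambda>t. 2 * t + 1)}"
    unfolding A_def by (intro attach_image odd_last odd_shift) simp
  have even: "attach 2 s ` (UNIV \<times> A) = {l \<in> gapped R. length l = Suc n \<and> last l \<in> range (\<lambda>t. 2 * t + 2)}"
    unfolding A_def by (intro attach_image even_last even_shift) simp
  have "2 * i + 1 \<noteq> 2 * j + (2::nat)" for i j by presburger
  then have disj: "attach 1 r ` (UNIV \<times> A) \<inter> attach 2 s ` (UNIV \<times> A) = {}"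
    unfolding odd even by (auto; presburger)
  have "last l \<in> range (\<lambda>t. 2 * t + 1) \<union> range (\<lambda>t. 2 * t + 2)"
    if "l \<in> gapped R" "length l = Suc n" for l
  proof -
    have "last l \<in> set l" using that by (intro last_in_set) auto
    then have "0 < last l" using that by (simp add: gapped_def)
    then have "\<exists>t. last l = 2 * t + 1 \<or> last l = 2 * t + 2" by presburger
    then show ?thesis by auto
  qed
  then have union: "{l \<in> gapped R. length l = Suc n} = attach 1 r ` (UNIV \<times> A) \<union> attach 2 s ` (UNIV \<times> A)"
    unfolding odd even by blast
  have "b = q ^ (r * n + 1) * a / (1 - q ^ (2 * Suc n)) + q ^ (s * n + 2) * a / (1 - q ^ (2 * Suc n))"
    using b one_minus_power_nonzero[OF q, of "2 * Suc n"]
    by (simp only: add_divide_distrib[symmetric] distrib_right[symmetric]) (simp add: eq_divide_eq)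
  moreover have "((\<lambda>l. q ^ sum_list l) has_sum q ^ (r * n + 1) * a / (1 - q ^ (2 * Suc n))
      + q ^ (s * n + 2) * a / (1 - q ^ (2 * Suc n))) (attach 1 r ` (UNIV \<times> A) \<union> attach 2 s ` (UNIV \<times> A))"
    by (intro has_sum_Un_disjoint attach_has_sum q disj) (use a in \<open>auto simp: A_def\<close>)
  ultimately show ?thesis
    unfolding union by (simp only:)
qed

section \<open>Sums over partitions with a fixed number of parts\<close>

lemma graded_coeff_0: "e 0 = 0 \<Longrightarrow> graded_coeff e q 0 = 1"
  by (simp add: graded_coeff_def qpoch_def)

lemma gapped_0_has_sum: "((\<lambda>l. (q::complex) ^ sum_list l) has_sum 1) {l \<in> gapped R. length l = 0}"
proof -
  have "{l \<in> gapped R. length l = 0} = {[]}" by (auto simp: gapped_def)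
  then show ?thesis by (simp add: has_sum_finiteI)
qed

lemma GG_fixed_length_has_sum:
  assumes "norm q < 1"
  shows "((\<lambda>l. q ^ sum_list l) has_sum graded_coeff (\<lambda>k. 2 * k\<^sup>2) q n) {l \<in> GG. length l = n}"
  unfolding GG_eq_gapped
proof (induction n)
  case 0
  then show ?case using gapped_0_has_sum by (simp add: graded_coeff_0)
next
  case (Suc n)
  show ?case
  \<comment> \<open>The next part must exceed 2t + 2 above 2t + 1, and 2t + 4 above 2t + 2. Both
    shifts are even, so \<open>gap_GG\<close> is preserved.\<close>
  proof (rule gapped_Suc_has_sum[OF assms _ _ _ _ Suc, where r = 2 and s = 4])
    show "gap_GG a (2 * t + 1) \<longleftrightarrow> 2 * t + 2 < a" for t a
      unfolding gap_GG_def by presburger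
    show "gap_GG a (2 * t + 2) \<longleftrightarrow> 2 * t + 4 < a" for t a
      unfolding gap_GG_def by presburger
  qed (use graded_coeff_GG_Suc[OF assms] in \<open>auto simp: gap_GG_def\<close>)
qed

lemma G_fixed_length_has_sum:
  assumes "norm q < 1"
  shows "((\<lambda>l. q ^ sum_list l) has_sum graded_coeff (\<lambda>k. 2 * k\<^sup>2 - 2 * k) q n) {l \<in> G. length l = n}"
  unfolding G_eq_gapped
proof (cases n)
  case 0
  then show "((\<lambda>l. q ^ sum_list l) has_sum graded_coeff (\<lambda>k. 2 * k\<^sup>2 - 2 * k) q n) {l \<in> gapped gap_G. length l = n}"
    using gapped_0_has_sum by (simp add: graded_coeff_0)
next
  case (Suc m)
  show "((\<lambda>l. q ^ sum_list l) has_sum graded_coeff (\<lambda>k. 2 * k\<^sup>2 - 2 * k) q n) {l \<in> gapped gap_G. length l = n}"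
    unfolding Suc
  \<comment> \<open>Above 2t + 1 as above 2t + 2, the next part must exceed 2t + 3. This odd shift
    turns \<open>gap_G\<close> into \<open>gap_GG\<close>, so a case split on n replaces
    induction.\<close>
  proof (rule gapped_Suc_has_sum[OF assms, where r = 3 and s = 3])
    show "gap_G a (2 * t + 1) \<longleftrightarrow> 2 * t + 3 < a" for t a
      unfolding gap_G_def by presburger
    show "gap_G a (2 * t + 2) \<longleftrightarrow> 2 * t + 3 < a" for t a
      unfolding gap_G_def by presburger
    show "((\<lambda>l. q ^ sum_list l) has_sum graded_coeff (\<lambda>k. 2 * k\<^sup>2) q m) {l \<in> gapped gap_GG. length l = m}"
      using GG_fixed_length_has_sum[OF assms] by (simp add: GG_eq_gapped)
  qed (use graded_coeff_G_Suc[OF assms] in \<open>auto simp: gap_G_def gap_GG_def\<close>)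
qed

theorem theorem1p2:
  fixes x q :: complex
  assumes "norm q < 1"
  shows "part_weight x q summable_on GG \<and>
         ((\<lambda>(k, m). (-1) ^ k * x ^ (m + 2 * k) * q ^ (m\<^sup>2 + 4 * m * k + 6 * k\<^sup>2)
              / (qpoch q q m * qpoch (q ^ 4) (q ^ 4) k))
            has_sum f_GG x q) (UNIV :: (nat \<times> nat) set) \<and>
         part_weight x q summable_on G \<and>
         ((\<lambda>(k, m). (-1) ^ k * x ^ (m + 2 * k) * q ^ (m\<^sup>2 + 4 * m * k + 6 * k\<^sup>2 - 2 * k)
              / (qpoch q q m * qpoch (q ^ 4) (q ^ 4) k))
            has_sum f_G x q) (UNIV :: (nat \<times> nat) set)"
proof -
  have GG_exp: "m\<^sup>2 + 4 * m * k + 6 * k\<^sup>2 = (m + 2 * k)\<^sup>2 + 2 * k\<^sup>2" for m k :: nat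
    by (simp add: power2_eq_square algebra_simps)
  \<comment> \<open>Lets the natural subtraction of 2k move onto the summand 2k^2 without
    truncation.\<close>
  have "2 * k \<le> 2 * k\<^sup>2" for k :: nat
    by (simp add: power2_eq_square)
  then have G_exp: "m\<^sup>2 + 4 * m * k + 6 * k\<^sup>2 - 2 * k = (m + 2 * k)\<^sup>2 + (2 * k\<^sup>2 - 2 * k)" for m k :: nat
    unfolding GG_exp by simp
  show ?thesis
    using part_weight_has_sum_double_series[where S = GG and x = x, OF assms GG_fixed_length_has_sum]
      part_weight_has_sum_double_series[where S = G and x = x, OF assms G_fixed_length_has_sum]
    unfolding G_exp unfolding GG_exp f_GG_def f_G_def by blast
qed

end
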